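(* (In $\mathrm{ZF}$.) For all $k,n\in\omega$, $\mathrm{nRC_{fin}}$ implies $\mathrm{RC}_{kn+1}$.
   Context: The base theory is $\mathrm{ZF}$ (no Axiom of Choice). For a set $x$ and $n\in\omega$, $[x]^n$ is the set of all $n$-element subsets of $x$ and $[x]^{>n}$ is the set of all finite subsets of $x$ with more than $n$ elements. $\mathrm{nRC_{fin}}$: given any infinite set $x$, there exist an infinite subset $y\subseteq x$ and a function $f\colon[y]^{>n}\to[y]^n$ such that $f(z)\subseteq z$ for all $z\in[y]^{>n}$. $\mathrm{RC}_n$: given any infinite set $x$, there exist an infinite subset $y\subseteq x$ and a function $f\colon[y]^n\to y$ such that $f(z)\in z$ for all $z\in[y]^n$. *)

theory Defs
  imports Main
begin

text \<open>
  HOL has a choice operator, so a theorem of ZF is rendered as a statement about an arbitrary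
  first-order structure with one binary relation that satisfies the ZF axioms. All sets, functions,
  natural numbers and finiteness notions below are those of the structure; HOL's own are
  never used (a model may have nonstandard natural numbers, and HOL functions on it need not be
  elements of it).

  Separation and Replacement must range over first-order formulas only: the versions for
  arbitrary HOL predicates would make Choice true in every model.
\<close>

datatype fm =
    Mem nat nat
  | Equ nat nat
  | Neg fm
  | Conj fm fm
  | Forall nat fm

primrec sat :: "('a \<Rightarrow> 'a \<Rightarrow> bool) \<Rightarrow> fm \<Rightarrow> (nat \<Rightarrow> 'a) \<Rightarrow> bool" where
  "sat E (Mem i j) e \<longleftrightarrow> E (e i) (e j)"
| "sat E (Equ i j) e \<longleftrightarrow> e i = e j"
| "sat E (Neg \<phi>) e \<longleftrightarrow> \<not> sat E \<phi> e"
| "sat E (Conj \<phi> \<psi>) e \<longleftrightarrow> sat E \<phi> e \<and> sat E \<psi> e"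
| "sat E (Forall i \<phi>) e \<longleftrightarrow> (\<forall>a. sat E \<phi> (e(i := a)))"

locale membership =
  fixes E :: "'a \<Rightarrow> 'a \<Rightarrow> bool"  (infix "\<^bold>\<in>" 50)
begin

definition subset :: "'a \<Rightarrow> 'a \<Rightarrow> bool"  (infix "\<^bold>\<subseteq>" 50) where
  "x \<^bold>\<subseteq> y \<longleftrightarrow> (\<forall>z. z \<^bold>\<in> x \<longrightarrow> z \<^bold>\<in> y)"

text \<open>The set of the model whose members are exactly the \<open>z\<close> with \<open>P z\<close>. It is meaningful only
  if there is such a set, which ZF proves for every use below.\<close>

definition coll :: "('a \<Rightarrow> bool) \<Rightarrow> 'a" where
  "coll P = (THE x. \<forall>z. z \<^bold>\<in> x \<longleftrightarrow> P z)"

definition zero :: 'a where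
  "zero = coll (\<lambda>z. False)"

definition succ :: "'a \<Rightarrow> 'a" where
  "succ x = coll (\<lambda>z. z \<^bold>\<in> x \<or> z = x)"

definition omega :: 'a where
  "omega = coll (\<lambda>n. \<forall>I. zero \<^bold>\<in> I \<and> (\<forall>x. x \<^bold>\<in> I \<longrightarrow> succ x \<^bold>\<in> I) \<longrightarrow> n \<^bold>\<in> I)"

definition upair :: "'a \<Rightarrow> 'a \<Rightarrow> 'a" where
  "upair a b = coll (\<lambda>z. z = a \<or> z = b)"

definition opair :: "'a \<Rightarrow> 'a \<Rightarrow> 'a" where
  "opair a b = upair (upair a a) (upair a b)"

definition is_fun :: "'a \<Rightarrow> 'a \<Rightarrow> 'a \<Rightarrow> bool" where
  "is_fun f a b \<longleftrightarrow>
     (\<forall>p. p \<^bold>\<in> f \<longrightarrow> (\<exists>u v. u \<^bold>\<in> a \<and> v \<^bold>\<in> b \<and> p = opair u v)) \<and>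
     (\<forall>u. u \<^bold>\<in> a \<longrightarrow> (\<exists>!v. opair u v \<^bold>\<in> f))"

definition app :: "'a \<Rightarrow> 'a \<Rightarrow> 'a" where
  "app f u = (THE v. opair u v \<^bold>\<in> f)"

definition is_bij :: "'a \<Rightarrow> 'a \<Rightarrow> 'a \<Rightarrow> bool" where
  "is_bij f a b \<longleftrightarrow> is_fun f a b \<and> (\<forall>v. v \<^bold>\<in> b \<longrightarrow> (\<exists>!u. u \<^bold>\<in> a \<and> app f u = v))"

definition equinumerous :: "'a \<Rightarrow> 'a \<Rightarrow> bool" where
  "equinumerous a b \<longleftrightarrow> (\<exists>f. is_bij f a b)"

definition is_finite :: "'a \<Rightarrow> bool" where
  "is_finite x \<longleftrightarrow> (\<exists>n. n \<^bold>\<in> omega \<and> equinumerous x n)"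

text \<open>Recursion on \<open>n\<close>: \<open>m + 0 = m\<close> and \<open>m + (i + 1) = (m + i) + 1\<close>; \<open>g\<close> lists the
  values \<open>m + 0, \<dots>, m + n\<close>.\<close>

definition plus_nat :: "'a \<Rightarrow> 'a \<Rightarrow> 'a" where
  "plus_nat m n = (THE p. \<exists>g. is_fun g (succ n) omega \<and> app g zero = m \<and>
     (\<forall>i. i \<^bold>\<in> n \<longrightarrow> app g (succ i) = succ (app g i)) \<and> app g n = p)"

text \<open>Recursion on \<open>m\<close>: \<open>0 n = 0\<close> and \<open>(i + 1) n = i n + n\<close>; \<open>g\<close> lists the
  values \<open>0 n, \<dots>, m n\<close>.\<close>

definition times_nat :: "'a \<Rightarrow> 'a \<Rightarrow> 'a" where
  "times_nat m n = (THE p. \<exists>g. is_fun g (succ m) omega \<and> app g zero = zero \<and>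
     (\<forall>i. i \<^bold>\<in> m \<longrightarrow> app g (succ i) = plus_nat (app g i) n) \<and> app g m = p)"

text \<open>\<open>[x]\<^sup>n\<close> and \<open>[x]\<^sup>>\<^sup>n\<close>; on natural numbers of the model, \<open><\<close> is membership.\<close>

definition subsets_eq :: "'a \<Rightarrow> 'a \<Rightarrow> 'a" where
  "subsets_eq x n = coll (\<lambda>z. z \<^bold>\<subseteq> x \<and> equinumerous z n)"

definition subsets_gt :: "'a \<Rightarrow> 'a \<Rightarrow> 'a" where
  "subsets_gt x n =
     coll (\<lambda>z. z \<^bold>\<subseteq> x \<and> (\<exists>m. m \<^bold>\<in> omega \<and> n \<^bold>\<in> m \<and> equinumerous z m))"

definition nRC_fin :: "'a \<Rightarrow> bool" where
  "nRC_fin n \<longleftrightarrow>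
     (\<forall>x. \<not> is_finite x \<longrightarrow>
        (\<exists>y f. y \<^bold>\<subseteq> x \<and> \<not> is_finite y \<and>
           is_fun f (subsets_gt y n) (subsets_eq y n) \<and>
           (\<forall>z. z \<^bold>\<in> subsets_gt y n \<longrightarrow> app f z \<^bold>\<subseteq> z)))"

definition RC :: "'a \<Rightarrow> bool" where
  "RC n \<longleftrightarrow>
     (\<forall>x. \<not> is_finite x \<longrightarrow>
        (\<exists>y f. y \<^bold>\<subseteq> x \<and> \<not> is_finite y \<and>
           is_fun f (subsets_eq y n) y \<and>
           (\<forall>z. z \<^bold>\<in> subsets_eq y n \<longrightarrow> app f z \<^bold>\<in> z)))"

end

text \<open>In the two schemas the variables 0 and 1 are the arguments of the class or class function
  and the remaining values of \<open>e\<close> are the parameters.\<close>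

locale ZF_model = membership +
  assumes extensionality:
      "\<And>x y. (\<forall>z. z \<^bold>\<in> x \<longleftrightarrow> z \<^bold>\<in> y) \<Longrightarrow> x = y"
    and foundation:
      "\<And>x. (\<exists>z. z \<^bold>\<in> x) \<Longrightarrow> \<exists>y. y \<^bold>\<in> x \<and> \<not> (\<exists>z. z \<^bold>\<in> x \<and> z \<^bold>\<in> y)"
    and pairing:
      "\<And>a b. \<exists>x. \<forall>z. z \<^bold>\<in> x \<longleftrightarrow> z = a \<or> z = b"
    and union:
      "\<And>x. \<exists>y. \<forall>z. z \<^bold>\<in> y \<longleftrightarrow> (\<exists>w. w \<^bold>\<in> x \<and> z \<^bold>\<in> w)"
    and power_set:
      "\<And>x. \<exists>y. \<forall>z. z \<^bold>\<in> y \<longleftrightarrow> z \<^bold>\<subseteq> x"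
    and infinity:
      "\<exists>I. (\<exists>z. z \<^bold>\<in> I \<and> (\<forall>w. \<not> w \<^bold>\<in> z)) \<and>
           (\<forall>x. x \<^bold>\<in> I \<longrightarrow> (\<exists>s. s \<^bold>\<in> I \<and> (\<forall>w. w \<^bold>\<in> s \<longleftrightarrow> w \<^bold>\<in> x \<or> w = x)))"
    and separation:
      "\<And>\<phi> e x. \<exists>y. \<forall>z. z \<^bold>\<in> y \<longleftrightarrow> z \<^bold>\<in> x \<and> sat E \<phi> (e(0 := z))"
    and replacement:
      "\<And>\<phi> e x.
         (\<forall>u v v'. u \<^bold>\<in> x \<and> sat E \<phi> (e(0 := u, 1 := v)) \<and> sat E \<phi> (e(0 := u, 1 := v')) \<longrightarrow> v = v') \<Longrightarrow>
         \<exists>y. \<forall>v. v \<^bold>\<in> y \<longleftrightarrow> (\<exists>u. u \<^bold>\<in> x \<and> sat E \<phi> (e(0 := u, 1 := v)))"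

end

theory Submission
  imports Defs
begin

text \<open>
  Let \<open>f\<close> choose an \<open>n\<close>-element subset of every finite subset of \<open>y\<close> with more than \<open>n\<close> elements.
  Removing \<open>f z\<close> from a set \<open>z\<close> with \<open>(k + 1) n + 1\<close> elements leaves \<open>k n + 1\<close> elements, so after \<open>k\<close>
  rounds a set with \<open>k n + 1\<close> elements is reduced to a single element. Since \<open>k\<close> may be nonstandard,
  this is an induction inside the model: from a choice function \<open>g\<close> for the sets with \<open>k n + 1\<close>
  elements one gets the choice function \<open>z \<mapsto> g (z - f z)\<close> for those with \<open>(k + 1) n + 1\<close>. The inductive
  statement has to be given by a first-order formula, which is derived from closure properties of
  definability rather than by writing formulas down.
\<close>

subsection \<open>Definability with parameters\<close>

primrec fv :: "fm \<Rightarrow> nat set" where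
  "fv (Mem i j) = {i, j}"
| "fv (Equ i j) = {i, j}"
| "fv (Neg \<phi>) = fv \<phi>"
| "fv (Conj \<phi> \<psi>) = fv \<phi> \<union> fv \<psi>"
| "fv (Forall i \<phi>) = fv \<phi> - {i}"

lemma finite_fv: "finite (fv \<phi>)"
  by (induction \<phi>) auto

lemma sat_cong: "(\<And>i. i \<in> fv \<phi> \<Longrightarrow> e i = e' i) \<Longrightarrow> sat E \<phi> e \<longleftrightarrow> sat E \<phi> e'"
proof (induction \<phi> arbitrary: e e')
  case (Neg \<phi>)
  have "sat E \<phi> e \<longleftrightarrow> sat E \<phi> e'"
    by (rule Neg.IH) (use Neg.prems in simp)
  then show ?case by simp
next
  case (Conj \<phi> \<psi>)
  have "sat E \<phi> e \<longleftrightarrow> sat E \<phi> e'" "sat E \<psi> e \<longleftrightarrow> sat E \<psi> e'"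
    by (rule Conj.IH, use Conj.prems in simp)+
  then show ?case by simp
next
  case (Forall i \<phi>)
  have "sat E \<phi> (e(i := a)) \<longleftrightarrow> sat E \<phi> (e'(i := a))" for a
    by (rule Forall.IH) (use Forall.prems in auto)
  then show ?case by simp
qed simp_all

text \<open>The map \<open>r\<close> is arbitrary: below it moves the variables of two formulas
  apart, and also identifies variables. Only the quantifier needs care, because of variable
  capture.\<close>

lemma sat_rename: "\<exists>\<psi>. \<forall>e. sat E \<psi> e \<longleftrightarrow> sat E \<phi> (\<lambda>i. e (r i))"
proof (induction \<phi> arbitrary: r)
  case (Mem i j)
  show ?case by (intro exI[of _ "Mem (r i) (r j)"]) simp
next
  case (Equ i j)
  show ?case by (intro exI[of _ "Equ (r i) (r j)"]) simp
next
  case (Neg \<phi>)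
  then show ?case by (metis sat.simps(3))
next
  case (Conj \<phi> \<psi>)
  then show ?case by (metis sat.simps(4))
next
  case (Forall i \<phi>)
  \<comment> \<open>The bound variable becomes a \<open>j\<close> outside the image of the free
    variables of the body, so assigning to \<open>j\<close> changes none of the renamed
    ones.\<close>
  obtain j where j: "j \<notin> r ` fv \<phi>"
    using ex_new_if_finite[OF infinite_UNIV_nat finite_imageI[OF finite_fv]] by blast
  obtain \<psi> where \<psi>: "\<And>e. sat E \<psi> e \<longleftrightarrow> sat E \<phi> (\<lambda>k. e ((r(i := j)) k))"
    using Forall[of "r(i := j)"] by blast
  have "sat E \<psi> (e(j := a)) \<longleftrightarrow> sat E \<phi> ((\<lambda>k. e (r k))(i := a))" for e a
    unfolding \<psi> using j by (intro sat_cong) auto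
  then show ?case by (intro exI[of _ "Forall j \<psi>"]) simp
qed

context membership
begin

text \<open>\<open>Inl\<close> marks the variables interpreted by parameters, \<open>Inr\<close> those interpreted by the
  assignment, which is used as a de Bruijn environment.\<close>

definition definable :: "((nat \<Rightarrow> 'a) \<Rightarrow> bool) \<Rightarrow> bool" where
  "definable P \<longleftrightarrow> (\<exists>\<phi> s. \<forall>e. P e \<longleftrightarrow> sat E \<phi> (\<lambda>i. case_sum id e (s i)))"

text \<open>The language has no function symbols, so a term is represented by its graph: entry 0
  holds the value, and the environment of the term is shifted by one.\<close>

definition definable_term :: "((nat \<Rightarrow> 'a) \<Rightarrow> 'a) \<Rightarrow> bool" where
  "definable_term t \<longleftrightarrow> definable (\<lambda>e. e 0 = t (\<lambda>i. e (Suc i)))"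

section \<open>Closure of definability under renaming, connectives and quantifiers\<close>

lemma definable_rename:
  assumes "definable P"
  shows "definable (\<lambda>e. P (\<lambda>i. e (r i)))"
proof -
  obtain \<phi> s where P: "\<And>e. P e \<longleftrightarrow> sat E \<phi> (\<lambda>i. case_sum id e (s i))"
    using assms unfolding definable_def by blast
  have "case_sum id (\<lambda>i. e (r i)) (s i) = case_sum id e (map_sum id r (s i))" for e i
    by (cases "s i") auto
  then have "P (\<lambda>i. e (r i)) \<longleftrightarrow> sat E \<phi> (\<lambda>i. case_sum id e (map_sum id r (s i)))" for e
    using P[of "\<lambda>i. e (r i)"] by presburger
  then show ?thesis unfolding definable_def
    by (intro exI[of _ \<phi>] exI[of _ "\<lambda>i. map_sum id r (s i)"] allI)
qed

lemma definable_neg: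
  assumes "definable P"
  shows "definable (\<lambda>e. \<not> P e)"
proof -
  obtain \<phi> s where "\<And>e. P e \<longleftrightarrow> sat E \<phi> (\<lambda>i. case_sum id e (s i))"
    using assms unfolding definable_def by blast
  then show ?thesis unfolding definable_def
    by (intro exI[of _ "Neg \<phi>"] exI[of _ s]) simp
qed

lemma definable_conj:
  assumes "definable P" "definable Q"
  shows "definable (\<lambda>e. P e \<and> Q e)"
proof -
  obtain \<phi> s where P: "\<And>e. P e \<longleftrightarrow> sat E \<phi> (\<lambda>i. case_sum id e (s i))"
    using assms(1) unfolding definable_def by blast
  obtain \<psi> t where Q: "\<And>e. Q e \<longleftrightarrow> sat E \<psi> (\<lambda>i. case_sum id e (t i))"
    using assms(2) unfolding definable_def by blast
  \<comment> \<open>The slot maps \<open>s\<close> and \<open>t\<close> may treat the same variable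
    differently, so \<phi> is moved to the even variables and \<psi> to the odd ones;
    \<open>u\<close> interleaves the two maps.\<close>
  obtain \<phi>' where \<phi>': "\<And>e. sat E \<phi>' e \<longleftrightarrow> sat E \<phi> (\<lambda>i. e (2 * i))"
    using sat_rename[of E \<phi>] by blast
  obtain \<psi>' where \<psi>': "\<And>e. sat E \<psi>' e \<longleftrightarrow> sat E \<psi> (\<lambda>i. e (Suc (2 * i)))"
    using sat_rename[of E \<psi> "\<lambda>i. Suc (2 * i)"] by blast
  define u where "u i = (if even i then s (i div 2) else t (i div 2))" for i
  have u: "u (2 * i) = s i" "u (Suc (2 * i)) = t i" for i
    by (simp_all add: u_def)
  have "P e \<and> Q e \<longleftrightarrow> sat E (Conj \<phi>' \<psi>') (\<lambda>i. case_sum id e (u i))" for e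
    unfolding P Q sat.simps \<phi>' \<psi>' u ..
  then show ?thesis unfolding definable_def
    by (intro exI[of _ "Conj \<phi>' \<psi>'"] exI[of _ u] allI)
qed

lemma definable_all:
  assumes "definable (\<lambda>e. Q (\<lambda>i. e (Suc i)) (e 0))"
  shows "definable (\<lambda>e. \<forall>a. Q e a)"
proof -
  obtain \<phi> s where \<phi>: "\<And>e. Q (\<lambda>i. e (Suc i)) (e 0) \<longleftrightarrow> sat E \<phi> (\<lambda>i. case_sum id e (s i))"
    using assms unfolding definable_def by blast
  have Q: "Q e a \<longleftrightarrow> sat E \<phi> (\<lambda>i. case_sum id (case_nat a e) (s i))" for e a
    using \<phi>[of "case_nat a e"] by simp
  \<comment> \<open>Several variables of \<phi> may have the slot \<open>Inr 0\<close>, that is,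
    stand for the quantified value. All of them are renamed to one fresh \<open>j\<close>, which
    \<open>Forall\<close> then binds.\<close>
  obtain j where j: "j \<notin> fv \<phi>"
    using ex_new_if_finite[OF infinite_UNIV_nat finite_fv] by blast
  obtain \<psi> where \<psi>: "\<And>e. sat E \<psi> e \<longleftrightarrow> sat E \<phi> (\<lambda>i. e (if s i = Inr 0 then j else i))"
    using sat_rename[of E \<phi> "\<lambda>i. if s i = Inr 0 then j else i"] by blast
  \<comment> \<open>Dropping entry 0 shifts the remaining slots down. The truncated
    \<open>0 - 1 = 0\<close> affects only slots \<open>Inr 0\<close>, whose variables now read
    \<open>j\<close> instead.\<close>
  define t where "t i = map_sum id (\<lambda>k. k - 1) (s i)" for i
  have "sat E \<psi> ((\<lambda>i. case_sum id e (t i))(j := a)) \<longleftrightarrow> Q e a" for e a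
    unfolding \<psi> Q using j
    by (intro sat_cong) (auto simp: t_def split: sum.split nat.split)
  then show ?thesis unfolding definable_def
    by (intro exI[of _ "Forall j \<psi>"] exI[of _ t]) simp
qed

lemma definable_ex:
  assumes "definable (\<lambda>e. Q (\<lambda>i. e (Suc i)) (e 0))"
  shows "definable (\<lambda>e. \<exists>a. Q e a)"
  using definable_neg[OF definable_all[where Q = "\<lambda>e a. \<not> Q e a", OF definable_neg[OF assms]]]
  by (simp only: not_all not_not)

lemma definable_disj:
  assumes "definable P" "definable Q"
  shows "definable (\<lambda>e. P e \<or> Q e)"
  using definable_neg[OF definable_conj[OF definable_neg[OF assms(1)] definable_neg[OF assms(2)]]]
  by (simp only: de_Morgan_conj not_not)

lemma definable_imp:
  assumes "definable P" "definable Q"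
  shows "definable (\<lambda>e. P e \<longrightarrow> Q e)"
  using definable_disj[OF definable_neg[OF assms(1)] assms(2)] by (simp only: imp_conv_disj)

lemma definable_iff:
  assumes "definable P" "definable Q"
  shows "definable (\<lambda>e. P e \<longleftrightarrow> Q e)"
  using definable_conj[OF definable_imp[OF assms] definable_imp[OF assms(2,1)]]
  by (simp only: iff_conv_conj_imp)

section \<open>Definable terms and substitution\<close>

lemma definable_term_var: "definable_term (\<lambda>e. e i)"
  unfolding definable_term_def definable_def
  by (intro exI[of _ "Equ 0 1"] exI[of _ "\<lambda>k. if k = 0 then Inr 0 else Inr (Suc i)"]) simp

lemma definable_term_param: "definable_term (\<lambda>e. c)"
  unfolding definable_term_def definable_def
  by (intro exI[of _ "Equ 0 1"] exI[of _ "\<lambda>k. if k = 0 then Inr 0 else Inl c"]) simp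

lemma definable_term_rename:
  assumes "definable_term t"
  shows "definable_term (\<lambda>e. t (\<lambda>i. e (r i)))"
  using definable_rename[OF assms[unfolded definable_term_def], of "case_nat 0 (\<lambda>i. Suc (r i))"]
  unfolding definable_term_def by simp

text \<open>The one-point rule: a quantified \<open>a\<close> equal to \<open>t e\<close> replaces
  the term, so that only the graph of \<open>t\<close> is used.\<close>

lemma definable_subst:
  assumes "definable (\<lambda>e. Q (\<lambda>i. e (Suc i)) (e 0))" "definable_term t"
  shows "definable (\<lambda>e. Q e (t e))"
proof -
  have "definable (\<lambda>e. \<exists>a. a = t e \<and> Q e a)"
    by (rule definable_ex[where Q = "\<lambda>e a. a = t e \<and> Q e a", OF definable_conj])
      (use assms in \<open>simp_all only: definable_term_def\<close>)
  then show ?thesis by simp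
qed

text \<open>\<open>definable_subst\<close> fills entry 0 only, so the arguments are permuted until
  each has stood there; terms inserted earlier appear shifted. The version for three arguments works
  in the same way.\<close>

lemma definable_subst2:
  assumes R: "definable (\<lambda>e. R (e 0) (e 1))" and t: "definable_term t" and u: "definable_term u"
  shows "definable (\<lambda>e. R (t e) (u e))"
proof -
  have "definable (\<lambda>e. R (e 1) (e 0))"
    using definable_rename[OF R, of "\<lambda>i. if i = 0 then 1 else 0"] by simp
  then have "definable (\<lambda>e. R (e 0) (u (\<lambda>i. e (Suc i))))"
    using definable_subst[where Q = "\<lambda>e. R (e 0)",
        OF _ definable_term_rename[where r = Suc, OF u]] by simp
  then show ?thesis
    by (rule definable_subst[where Q = "\<lambda>e a. R a (u e)", OF _ t])
qed

lemma definable_subst3: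
  assumes R: "definable (\<lambda>e. R (e 0) (e 1) (e 2))"
    and t: "definable_term t" and u: "definable_term u" and v: "definable_term v"
  shows "definable (\<lambda>e. R (t e) (u e) (v e))"
proof -
  have "definable (\<lambda>e. R (e 1) (e 2) (e 0))"
    using definable_rename[OF R, of "\<lambda>i. if i = 0 then 1 else if i = 1 then 2 else 0"] by simp
  then have "definable (\<lambda>e. R (e 0) (e 1) (v (\<lambda>i. e (Suc (Suc i)))))"
    using definable_subst[where Q = "\<lambda>e. R (e 0) (e 1)",
        OF _ definable_term_rename[where r = "\<lambda>i. Suc (Suc i)", OF v]]
    by (simp add: numeral_2_eq_2)
  then have "definable (\<lambda>e. R (e 1) (e 0) (v (\<lambda>i. e (Suc (Suc i)))))"
    using definable_rename[of "\<lambda>e. R (e 0) (e 1) (v (\<lambda>i. e (Suc (Suc i))))"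
        "\<lambda>i. if i = 0 then 1 else if i = 1 then 0 else i"]
    by simp
  then have "definable (\<lambda>e. R (e 0) (u (\<lambda>i. e (Suc i))) (v (\<lambda>i. e (Suc i))))"
    using definable_subst[where Q = "\<lambda>e a. R (e 0) a (v (\<lambda>i. e (Suc i)))",
        OF _ definable_term_rename[where r = Suc, OF u]] by simp
  then show ?thesis
    by (rule definable_subst[where Q = "\<lambda>e a. R a (u e) (v e)", OF _ t])
qed

lemma definable_term_subst1:
  assumes "definable (\<lambda>e. e 0 = h (e 1))" "definable_term t"
  shows "definable_term (\<lambda>e. h (t e))"
  unfolding definable_term_def
  by (rule definable_subst2[where R = "\<lambda>x y. x = h y",
        OF assms(1) definable_term_var definable_term_rename[where r = Suc, OF assms(2)]])

lemma definable_term_subst2: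
  assumes "definable (\<lambda>e. e 0 = h (e 1) (e 2))" "definable_term t" "definable_term u"
  shows "definable_term (\<lambda>e. h (t e) (u e))"
  unfolding definable_term_def
  by (rule definable_subst3[where R = "\<lambda>x y z. x = h y z", OF assms(1) definable_term_var
        definable_term_rename[where r = Suc, OF assms(2)] definable_term_rename[where r = Suc, OF assms(3)]])

lemma definable_eq:
  assumes "definable_term t" "definable_term u"
  shows "definable (\<lambda>e. t e = u e)"
proof (rule definable_subst2[OF _ assms])
  show "definable (\<lambda>e. e 0 = e 1)"
    unfolding definable_def by (intro exI[of _ "Equ 0 1"] exI[of _ Inr]) simp
qed

lemma definable_mem:
  assumes "definable_term t" "definable_term u"
  shows "definable (\<lambda>e. t e \<^bold>\<in> u e)"
proof (rule definable_subst2[OF _ assms])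
  show "definable (\<lambda>e. e 0 \<^bold>\<in> e 1)"
    unfolding definable_def by (intro exI[of _ "Mem 0 1"] exI[of _ Inr]) simp
qed

text \<open>Used with \<open>intro\<close> to decompose a predicate. A \<open>coll\<close> or
  \<open>THE\<close> term that depends on the environment needs a rule of its own or a prior
  rewriting into membership; a constant one counts as a parameter.\<close>

lemmas definable_intros =
  definable_neg definable_conj definable_disj definable_imp definable_iff definable_all definable_ex
  definable_mem definable_eq definable_term_var definable_term_param

lemma definable_subset:
  assumes "definable_term t" "definable_term u"
  shows "definable (\<lambda>e. t e \<^bold>\<subseteq> u e)"
proof (rule definable_subst2[OF _ assms])
  show "definable (\<lambda>e. e 0 \<^bold>\<subseteq> e 1)"
    unfolding subset_def by (intro definable_intros)
qed

end

subsection \<open>Sets and functions in a model of ZF\<close>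

context ZF_model
begin

lemma eq_iff: "x = y \<longleftrightarrow> (\<forall>z. z \<^bold>\<in> x \<longleftrightarrow> z \<^bold>\<in> y)"
  using extensionality by blast

lemma mem_coll:
  assumes "\<exists>x. \<forall>z. z \<^bold>\<in> x \<longleftrightarrow> P z"
  shows "z \<^bold>\<in> coll P \<longleftrightarrow> P z"
proof -
  have "\<exists>!x. \<forall>z. z \<^bold>\<in> x \<longleftrightarrow> P z"
    using assms extensionality by blast
  from theI'[OF this] show ?thesis unfolding coll_def by blast
qed

lemma separation_definable:
  assumes "definable (\<lambda>e. P (e 0))"
  shows "\<exists>y. \<forall>z. z \<^bold>\<in> y \<longleftrightarrow> z \<^bold>\<in> x \<and> P z"
proof -
  obtain \<phi> and s :: "nat \<Rightarrow> 'a + nat"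
    where \<phi>: "\<And>e. P (e 0) \<longleftrightarrow> sat E \<phi> (\<lambda>i. case_sum id e (s i))"
    using assms unfolding definable_def by blast
  \<comment> \<open>The predicate looks at entry 0 only, so the environment may be constantly
    \<open>z\<close> and every \<open>Inr\<close> slot goes to variable 0. The parameter of slot
    \<open>i\<close> is stored at \<open>Suc i\<close>; \<open>undefined\<close> fills positions
    that no renamed variable reads.\<close>
  let ?r = "\<lambda>i. case s i of Inl c \<Rightarrow> Suc i | Inr j \<Rightarrow> 0"
  let ?e = "\<lambda>i. case s (i - 1) of Inl c \<Rightarrow> c | Inr j \<Rightarrow> undefined"
  obtain \<psi> where \<psi>: "\<And>e. sat E \<psi> e \<longleftrightarrow> sat E \<phi> (\<lambda>i. e (?r i))"
    using sat_rename[of E \<phi> ?r] by blast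
  have "case_sum id (\<lambda>_. z) (s i) = (?e(0 := z)) (?r i)" for z i
    by (simp split: sum.split)
  then have "P z \<longleftrightarrow> sat E \<psi> (?e(0 := z))" for z
    using \<phi>[of "\<lambda>_. z"] unfolding \<psi> by presburger
  then show ?thesis
    using separation[of x \<psi> ?e] by simp
qed

lemma mem_coll_bounded:
  assumes "definable (\<lambda>e. P (e 0))" "\<And>z. P z \<Longrightarrow> z \<^bold>\<in> x"
  shows "z \<^bold>\<in> coll P \<longleftrightarrow> P z"
  using separation_definable[OF assms(1), of x] assms(2) by (intro mem_coll) blast

lemma not_mem_zero [simp]: "\<not> z \<^bold>\<in> zero"
  unfolding zero_def using infinity by (subst mem_coll) auto

lemma mem_upair [simp]: "z \<^bold>\<in> upair a b \<longleftrightarrow> z = a \<or> z = b"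
  unfolding upair_def by (rule mem_coll[OF pairing])

lemma union2: "\<exists>x. \<forall>z. z \<^bold>\<in> x \<longleftrightarrow> z \<^bold>\<in> a \<or> z \<^bold>\<in> b"
  using union[of "upair a b"] by auto

lemma mem_succ [simp]: "z \<^bold>\<in> succ x \<longleftrightarrow> z \<^bold>\<in> x \<or> z = x"
  unfolding succ_def using union2[of x "upair x x"] by (intro mem_coll) simp

lemma opair_eq_iff [simp]: "opair a b = opair c d \<longleftrightarrow> a = c \<and> b = d"
proof
  assume "opair a b = opair c d"
  then have "z = upair a a \<or> z = upair a b \<longleftrightarrow> z = upair c c \<or> z = upair c d" for z
    unfolding opair_def by (metis mem_upair)
  then show "a = c \<and> b = d"
    by (metis mem_upair)
qed simp

lemma mem_irrefl [simp]: "\<not> x \<^bold>\<in> x"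
  using foundation[of "upair x x"] by auto

text \<open>Extensionality turns the graph of the operation into a first-order condition on members;
  \<open>succ\<close> is treated likewise.\<close>

lemma definable_upair:
  assumes "definable_term t" "definable_term u"
  shows "definable_term (\<lambda>e. upair (t e) (u e))"
proof (rule definable_term_subst2[OF _ assms])
  show "definable (\<lambda>e. e 0 = upair (e 1) (e 2))"
    unfolding eq_iff[of _ "upair _ _"] mem_upair by (intro definable_intros)
qed

lemma definable_opair:
  assumes "definable_term t" "definable_term u"
  shows "definable_term (\<lambda>e. opair (t e) (u e))"
  unfolding opair_def by (intro definable_upair assms)

lemma definable_succ:
  assumes "definable_term t"
  shows "definable_term (\<lambda>e. succ (t e))"
proof (rule definable_term_subst1[OF _ assms])
  show "definable (\<lambda>e. e 0 = succ (e 1))"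
    unfolding eq_iff[of _ "succ _"] mem_succ by (intro definable_intros)
qed

lemmas definable_set_intros = definable_intros definable_subset definable_opair definable_succ

section \<open>The natural numbers of the model\<close>

lemma mem_omega: "n \<^bold>\<in> omega \<longleftrightarrow> (\<forall>I. zero \<^bold>\<in> I \<and> (\<forall>x. x \<^bold>\<in> I \<longrightarrow> succ x \<^bold>\<in> I) \<longrightarrow> n \<^bold>\<in> I)"
proof -
  obtain I where I: "\<exists>z. z \<^bold>\<in> I \<and> (\<forall>w. \<not> w \<^bold>\<in> z)"
    "\<And>x. x \<^bold>\<in> I \<Longrightarrow> \<exists>s. s \<^bold>\<in> I \<and> (\<forall>w. w \<^bold>\<in> s \<longleftrightarrow> w \<^bold>\<in> x \<or> w = x)"
    using infinity by blast
  \<comment> \<open>The axiom of infinity mentions neither \<open>zero\<close> nor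
    \<open>succ\<close>; extensionality identifies its witnesses with them. Hence \<open>I\<close>
    is inductive and bounds the class that defines \<open>omega\<close>.\<close>
  have "zero \<^bold>\<in> I"
    using I(1) by (metis eq_iff not_mem_zero)
  moreover have "succ x \<^bold>\<in> I" if "x \<^bold>\<in> I" for x
    using I(2)[OF that] by (metis eq_iff mem_succ)
  ultimately show ?thesis
    unfolding omega_def
    by (intro mem_coll_bounded[where x = I] definable_set_intros) blast
qed

lemma zero_in_omega [simp]: "zero \<^bold>\<in> omega"
  and succ_in_omega [simp]: "n \<^bold>\<in> omega \<Longrightarrow> succ n \<^bold>\<in> omega"
  unfolding mem_omega by blast+

text \<open>Separation cuts out the members of \<open>omega\<close> that satisfy \<open>P\<close>,
  and this set is inductive. The case \<open>definable\<close> is essential to that: an arbitrary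
  HOL predicate need not cut out a set of the model.\<close>

lemma omega_induct [consumes 1, case_names definable zero succ]:
  assumes "n \<^bold>\<in> omega" and P: "definable (\<lambda>e. P (e 0))"
    and "P zero" and "\<And>n. n \<^bold>\<in> omega \<Longrightarrow> P n \<Longrightarrow> P (succ n)"
  shows "P n"
proof -
  obtain I where I: "\<And>z. z \<^bold>\<in> I \<longleftrightarrow> z \<^bold>\<in> omega \<and> P z"
    using separation_definable[OF P, of omega] by blast
  have "n \<^bold>\<in> I"
    using assms(1) unfolding mem_omega[of n] by (rule allE[of _ I]) (simp add: I assms)
  then show ?thesis by (simp add: I)
qed

lemma omega_trans:
  assumes "n \<^bold>\<in> omega" "m \<^bold>\<in> n"
  shows "m \<^bold>\<in> omega"
proof -
  have "\<forall>m. m \<^bold>\<in> n \<longrightarrow> m \<^bold>\<in> omega"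
    using assms(1)
  proof (induction rule: omega_induct)
    case definable
    show ?case by (intro definable_set_intros)
  qed auto
  then show ?thesis using assms(2) by blast
qed

lemma mem_omega_trans:
  assumes "n \<^bold>\<in> omega" "m \<^bold>\<in> n" "l \<^bold>\<in> m"
  shows "l \<^bold>\<in> n"
proof -
  have "\<forall>m l. m \<^bold>\<in> n \<longrightarrow> l \<^bold>\<in> m \<longrightarrow> l \<^bold>\<in> n"
    using assms(1)
  proof (induction rule: omega_induct)
    case definable
    show ?case by (intro definable_set_intros)
  qed auto
  then show ?thesis using assms by blast
qed

lemma zero_in_succ:
  assumes "n \<^bold>\<in> omega"
  shows "zero \<^bold>\<in> succ n"
  using assms
proof (induction rule: omega_induct)
  case definable
  show ?case by (intro definable_set_intros)
qed auto

lemma succ_in_succ_iff: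
  assumes "n \<^bold>\<in> omega"
  shows "succ m \<^bold>\<in> succ n \<longleftrightarrow> m \<^bold>\<in> n"
proof
  assume "succ m \<^bold>\<in> succ n"
  then show "m \<^bold>\<in> n"
    using mem_omega_trans[OF assms, of "succ m" m] by auto
next
  have "\<forall>m. m \<^bold>\<in> n \<longrightarrow> succ m \<^bold>\<in> succ n"
    using assms
  proof (induction rule: omega_induct)
    case definable
    show ?case by (intro definable_set_intros)
  qed auto
  then show "m \<^bold>\<in> n \<Longrightarrow> succ m \<^bold>\<in> succ n" by blast
qed

section \<open>Relations and functions as sets of the model\<close>

lemma relation_ex:
  assumes "definable (\<lambda>e. R (e 0) (e 1))"
  shows "\<exists>f. \<forall>p. p \<^bold>\<in> f \<longleftrightarrow> (\<exists>u v. u \<^bold>\<in> a \<and> v \<^bold>\<in> b \<and> R u v \<and> p = opair u v)"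
proof -
  \<comment> \<open>The Kuratowski pairs over \<open>a\<close> and \<open>b\<close> all lie in the
    double power set of the union, so Separation suffices.\<close>
  obtain c where c: "\<And>z. z \<^bold>\<in> c \<longleftrightarrow> z \<^bold>\<in> a \<or> z \<^bold>\<in> b"
    using union2 by blast
  obtain d where d: "\<And>z. z \<^bold>\<in> d \<longleftrightarrow> z \<^bold>\<subseteq> c"
    using power_set by blast
  obtain x where x: "\<And>z. z \<^bold>\<in> x \<longleftrightarrow> z \<^bold>\<subseteq> d"
    using power_set by blast
  have "opair u v \<^bold>\<in> x" if "u \<^bold>\<in> a" "v \<^bold>\<in> b" for u v
    using that by (auto simp: x d c subset_def opair_def)
  moreover have "definable (\<lambda>e. \<exists>u v. u \<^bold>\<in> a \<and> v \<^bold>\<in> b \<and> R u v \<and> e 0 = opair u v)"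
    by (intro definable_set_intros definable_subst2[OF assms])
  from separation_definable[OF this] obtain f
    where "\<And>p. p \<^bold>\<in> f \<longleftrightarrow> p \<^bold>\<in> x \<and> (\<exists>u v. u \<^bold>\<in> a \<and> v \<^bold>\<in> b \<and> R u v \<and> p = opair u v)"
    by blast
  ultimately show ?thesis by (intro exI[of _ f]) blast
qed

lemma fun_ex:
  assumes "definable (\<lambda>e. R (e 0) (e 1))"
    and "\<And>u. u \<^bold>\<in> a \<Longrightarrow> \<exists>v. v \<^bold>\<in> b \<and> R u v"
    and "\<And>u v w. u \<^bold>\<in> a \<Longrightarrow> R u v \<Longrightarrow> R u w \<Longrightarrow> v = w"
  shows "\<exists>f. is_fun f a b \<and> (\<forall>u v. opair u v \<^bold>\<in> f \<longleftrightarrow> u \<^bold>\<in> a \<and> v \<^bold>\<in> b \<and> R u v)"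
proof -
  obtain f where f: "\<And>p. p \<^bold>\<in> f \<longleftrightarrow> (\<exists>u v. u \<^bold>\<in> a \<and> v \<^bold>\<in> b \<and> R u v \<and> p = opair u v)"
    using relation_ex[OF assms(1)] by blast
  have "\<exists>!v. opair u v \<^bold>\<in> f" if "u \<^bold>\<in> a" for u
    using assms(2)[OF that] assms(3)[OF that] that by (auto simp: f)
  then have "is_fun f a b"
    unfolding is_fun_def by (auto simp: f)
  then show ?thesis by (intro exI[of _ f]) (auto simp: f)
qed

text \<open>The bridge from the \<open>THE\<close> term \<open>app\<close> to membership of a pair
  in the graph, on which definability proofs rely.\<close>

lemma app_eq_iff:
  assumes "is_fun f a b" "u \<^bold>\<in> a"
  shows "app f u = v \<longleftrightarrow> opair u v \<^bold>\<in> f"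
proof -
  have *: "\<exists>!v. opair u v \<^bold>\<in> f"
    using assms unfolding is_fun_def by blast
  show ?thesis unfolding app_def using theI'[OF *] * by blast
qed

lemma opair_in_fun:
  assumes "is_fun f a b" "opair u v \<^bold>\<in> f"
  shows "u \<^bold>\<in> a" "v \<^bold>\<in> b"
  using assms unfolding is_fun_def by fastforce+

lemma app_in:
  assumes "is_fun f a b" "u \<^bold>\<in> a"
  shows "app f u \<^bold>\<in> b"
  using app_eq_iff[OF assms] opair_in_fun[OF assms(1)] by blast

lemma definable_is_fun:
  assumes "definable_term t" "definable_term u" "definable_term v"
  shows "definable (\<lambda>e. is_fun (t e) (u e) (v e))"
proof (rule definable_subst3[OF _ assms])
  show "definable (\<lambda>e. is_fun (e 0) (e 1) (e 2))"
    unfolding is_fun_def Ex1_def by (intro definable_set_intros)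
qed

subsection \<open>Recursion and arithmetic on the natural numbers of the model\<close>

text \<open>The common shape of the recursions behind \<open>plus_nat\<close> and
  \<open>times_nat\<close>, with initial value \<open>a\<close> and step function
  \<open>H\<close>.\<close>

definition rec_seq :: "'a \<Rightarrow> ('a \<Rightarrow> 'a) \<Rightarrow> 'a \<Rightarrow> 'a \<Rightarrow> bool" where
  "rec_seq a H n g \<longleftrightarrow> is_fun g (succ n) omega \<and> app g zero = a \<and>
     (\<forall>i. i \<^bold>\<in> n \<longrightarrow> app g (succ i) = H (app g i))"

definition nat_rec :: "'a \<Rightarrow> ('a \<Rightarrow> 'a) \<Rightarrow> 'a \<Rightarrow> 'a" where
  "nat_rec a H n = (THE p. \<exists>g. rec_seq a H n g \<and> app g n = p)"

text \<open>Eliminates \<open>app\<close> in favour of pairs. The guard that \<open>u\<close> lies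
  in \<open>omega\<close> accompanies \<open>v = H u\<close> because the step functions are treated
  as definable on \<open>omega\<close> only.\<close>

lemma rec_seq_iff:
  assumes "n \<^bold>\<in> omega"
  shows "rec_seq a H n g \<longleftrightarrow> is_fun g (succ n) omega \<and> opair zero a \<^bold>\<in> g \<and>
    (\<forall>i. i \<^bold>\<in> n \<longrightarrow> (\<exists>u v. opair i u \<^bold>\<in> g \<and> opair (succ i) v \<^bold>\<in> g \<and> u \<^bold>\<in> omega \<and> v = H u))"
proof (cases "is_fun g (succ n) omega")
  case True
  have "app g (succ i) = H (app g i) \<longleftrightarrow>
      (\<exists>u v. opair i u \<^bold>\<in> g \<and> opair (succ i) v \<^bold>\<in> g \<and> u \<^bold>\<in> omega \<and> v = H u)" if "i \<^bold>\<in> n" for i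
  proof -
    have i: "i \<^bold>\<in> succ n" "succ i \<^bold>\<in> succ n"
      using that succ_in_succ_iff[OF assms] by auto
    show ?thesis
      using app_eq_iff[OF True i(1)] app_eq_iff[OF True i(2)] app_in[OF True i(1)] by metis
  qed
  then show ?thesis
    using app_eq_iff[OF True zero_in_succ[OF assms]] by (simp add: rec_seq_def)
qed (simp add: rec_seq_def)

text \<open>The two lengths may differ, so that a sequence for \<open>n\<close> can be compared with
  one for \<open>succ n\<close>. The induction on \<open>i\<close> is phrased with pairs to remain
  definable.\<close>

lemma rec_seq_unique:
  assumes n: "n \<^bold>\<in> omega" "rec_seq a H n g" and m: "m \<^bold>\<in> omega" "rec_seq a H m h"
    and i: "i \<^bold>\<in> succ n" "i \<^bold>\<in> succ m"
  shows "app g i = app h i"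
proof -
  have g: "is_fun g (succ n) omega" and h: "is_fun h (succ m) omega"
    using assms unfolding rec_seq_def by blast+
  have "i \<^bold>\<in> omega"
    using omega_trans[OF succ_in_omega[OF n(1)] i(1)] .
  then have "i \<^bold>\<in> succ n \<longrightarrow> i \<^bold>\<in> succ m \<longrightarrow> (\<exists>v. opair i v \<^bold>\<in> g \<and> opair i v \<^bold>\<in> h)"
  proof (induction rule: omega_induct)
    case definable
    show ?case by (intro definable_set_intros)
  next
    case zero
    then show ?case
      using n(2) m(2) unfolding rec_seq_iff[OF n(1)] rec_seq_iff[OF m(1)] by blast
  next
    case (succ i)
    show ?case
    proof (intro impI)
      assume si: "succ i \<^bold>\<in> succ n" "succ i \<^bold>\<in> succ m"
      then have i: "i \<^bold>\<in> n" "i \<^bold>\<in> m"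
        using succ_in_succ_iff n(1) m(1) by blast+
      then obtain v where "opair i v \<^bold>\<in> g" "opair i v \<^bold>\<in> h"
        using succ.IH by auto
      then have "app g i = app h i"
        using app_eq_iff[OF g, of i v] app_eq_iff[OF h, of i v] i by simp
      then have "app g (succ i) = app h (succ i)"
        using n(2) m(2) i unfolding rec_seq_def by simp
      then show "\<exists>v. opair (succ i) v \<^bold>\<in> g \<and> opair (succ i) v \<^bold>\<in> h"
        using app_eq_iff[OF g si(1)] app_eq_iff[OF h si(2)] by blast
    qed
  qed
  then show ?thesis
    using i app_eq_iff[OF g i(1)] app_eq_iff[OF h i(2)] by metis
qed

text \<open>The step function is required to be definable on \<open>omega\<close> only: \<open>plus_nat\<close> is a \<open>THE\<close> term, about
  whose values outside \<open>omega\<close> nothing is known.\<close>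

context
  fixes H :: "'a \<Rightarrow> 'a"
  assumes H_definable: "definable (\<lambda>e. e 0 \<^bold>\<in> omega \<and> e 1 = H (e 0))"
    and H_closed: "\<And>u. u \<^bold>\<in> omega \<Longrightarrow> H u \<^bold>\<in> omega"
begin

lemma definable_rec_seq:
  assumes "definable_term t" "definable_term u" "definable_term v"
  shows "definable (\<lambda>e. u e \<^bold>\<in> omega \<and> rec_seq (t e) H (u e) (v e))"
proof (rule definable_subst3[where R = "\<lambda>x y z. y \<^bold>\<in> omega \<and> rec_seq x H y z", OF _ assms])
  \<comment> \<open>The conjunct on \<open>e 1\<close> comes first so that \<open>conj_cong\<close>
    can use it as the hypothesis of \<open>rec_seq_iff\<close>.\<close>
  show "definable (\<lambda>e. e 1 \<^bold>\<in> omega \<and> rec_seq (e 0) H (e 1) (e 2))"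
    by (simp only: rec_seq_iff cong: conj_cong)
      (intro definable_subst2[OF H_definable] definable_is_fun definable_set_intros)
qed

text \<open>Induction on the length: a sequence for \<open>n\<close> is extended by the single pair
  of \<open>succ n\<close> and \<open>H (app g n)\<close>.\<close>

lemma rec_seq_ex:
  assumes "n \<^bold>\<in> omega" "a \<^bold>\<in> omega"
  shows "\<exists>g. rec_seq a H n g"
proof -
  have "\<exists>g. n \<^bold>\<in> omega \<and> rec_seq a H n g"
    using assms(1)
  proof (induction rule: omega_induct)
    case definable
    show ?case by (intro definable_rec_seq definable_set_intros)
  next
    case zero
    have "definable (\<lambda>e. e 1 = a)"
      by (intro definable_set_intros)
    then have "\<exists>g. is_fun g (succ zero) omega \<and>
        (\<forall>u v. opair u v \<^bold>\<in> g \<longleftrightarrow> u \<^bold>\<in> succ zero \<and> v \<^bold>\<in> omega \<and> v = a)"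
      by (rule fun_ex[where R = "\<lambda>u v. v = a"]) (use assms(2) in auto)
    then obtain g where "rec_seq a H zero g"
      using assms(2) by (auto simp: rec_seq_iff)
    then show ?case by auto
  next
    case (succ n)
    note n = \<open>n \<^bold>\<in> omega\<close>
    obtain g where g: "rec_seq a H n g"
      using succ.IH by blast
    then have fg: "is_fun g (succ n) omega"
      by (simp add: rec_seq_def)
    have "definable (\<lambda>e. opair (e 0) (e 1) \<^bold>\<in> g \<or> e 0 = succ n \<and> e 1 = H (app g n))"
      by (intro definable_set_intros)
    \<comment> \<open>The domain \<open>succ n\<close> of \<open>g\<close> does not contain itself,
      so the added pair cannot conflict with an old one.\<close>
    moreover have "\<not> opair (succ n) v \<^bold>\<in> g" for v
      using opair_in_fun(1)[OF fg, of "succ n" v] mem_irrefl[of "succ n"] by blast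
    moreover have "\<exists>v. v \<^bold>\<in> omega \<and> (opair u v \<^bold>\<in> g \<or> u = succ n \<and> v = H (app g n))"
      if "u \<^bold>\<in> succ (succ n)" for u
    proof (cases "u = succ n")
      case True
      then show ?thesis
        using H_closed[OF app_in[OF fg, of n]] by auto
    next
      case False
      then have "u \<^bold>\<in> succ n" using that by simp
      then show ?thesis using app_in[OF fg] app_eq_iff[OF fg] by blast
    qed
    moreover have "v = w" if "opair u v \<^bold>\<in> g" "opair u w \<^bold>\<in> g" for u v w
      using that app_eq_iff[OF fg opair_in_fun(1)[OF fg]] by metis
    ultimately have "\<exists>h. is_fun h (succ (succ n)) omega \<and> (\<forall>u v. opair u v \<^bold>\<in> h \<longleftrightarrow>
        u \<^bold>\<in> succ (succ n) \<and> v \<^bold>\<in> omega \<and> (opair u v \<^bold>\<in> g \<or> u = succ n \<and> v = H (app g n)))"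
      by (intro fun_ex) blast+
    then obtain h where fh: "is_fun h (succ (succ n)) omega" and h: "\<And>u v. opair u v \<^bold>\<in> h \<longleftrightarrow>
        u \<^bold>\<in> succ (succ n) \<and> v \<^bold>\<in> omega \<and> (opair u v \<^bold>\<in> g \<or> u = succ n \<and> v = H (app g n))"
      by blast
    have gh: "opair u v \<^bold>\<in> h" if "opair u v \<^bold>\<in> g" for u v
      using that opair_in_fun[OF fg that] by (simp add: h)
    have "rec_seq a H (succ n) h"
      unfolding rec_seq_iff[OF succ_in_omega[OF n]]
    proof (intro conjI allI impI fh)
      show "opair zero a \<^bold>\<in> h"
        using g gh unfolding rec_seq_iff[OF n] by blast
      fix i assume "i \<^bold>\<in> succ n"
      then consider "i \<^bold>\<in> n" | "i = n" by auto
      then show "\<exists>u v. opair i u \<^bold>\<in> h \<and> opair (succ i) v \<^bold>\<in> h \<and> u \<^bold>\<in> omega \<and> v = H u"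
      proof cases
        case 1
        then show ?thesis using g gh unfolding rec_seq_iff[OF n] by blast
      next
        case 2
        have "opair n (app g n) \<^bold>\<in> h"
          using app_eq_iff[OF fg, of n "app g n"] by (simp add: gh)
        moreover have "app g n \<^bold>\<in> omega"
          using app_in[OF fg, of n] by simp
        moreover from this have "opair (succ n) (H (app g n)) \<^bold>\<in> h"
          by (simp add: h H_closed)
        ultimately show ?thesis using 2 by blast
      qed
    qed
    then show ?case using n by auto
  qed
  then show ?thesis by blast
qed

lemma nat_rec_eq:
  assumes "n \<^bold>\<in> omega" "rec_seq a H n g"
  shows "nat_rec a H n = app g n"
  unfolding nat_rec_def
proof (rule the_equality)
  fix p assume "\<exists>h. rec_seq a H n h \<and> app h n = p"
  then show "p = app g n"
    using rec_seq_unique[OF assms(1) _ assms] by auto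
qed (use assms in blast)

lemma nat_rec_in:
  assumes "n \<^bold>\<in> omega" "a \<^bold>\<in> omega"
  shows "nat_rec a H n \<^bold>\<in> omega"
proof -
  obtain g where g: "rec_seq a H n g"
    using rec_seq_ex[OF assms] by blast
  then show ?thesis
    using nat_rec_eq[OF assms(1) g] app_in[of g "succ n" omega n] by (simp add: rec_seq_def)
qed

lemma nat_rec_zero:
  assumes "a \<^bold>\<in> omega"
  shows "nat_rec a H zero = a"
proof -
  obtain g where g: "rec_seq a H zero g"
    using rec_seq_ex[OF zero_in_omega assms] by blast
  then show ?thesis
    using nat_rec_eq[OF zero_in_omega g] by (simp add: rec_seq_def)
qed

lemma nat_rec_succ:
  assumes "n \<^bold>\<in> omega" "a \<^bold>\<in> omega"
  shows "nat_rec a H (succ n) = H (nat_rec a H n)"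
proof -
  obtain g where g: "rec_seq a H n g"
    using rec_seq_ex[OF assms] by blast
  obtain h where h: "rec_seq a H (succ n) h"
    using rec_seq_ex[OF succ_in_omega[OF assms(1)] assms(2)] by blast
  have "app h n = app g n"
    by (rule rec_seq_unique[OF _ h assms(1) g]) (simp_all add: assms)
  then show ?thesis
    using nat_rec_eq[OF assms(1) g] nat_rec_eq[OF succ_in_omega[OF assms(1)] h] h
    by (simp add: rec_seq_def)
qed

lemma definable_nat_rec:
  assumes "definable_term t" "definable_term u" "definable_term v"
  shows "definable (\<lambda>e. t e \<^bold>\<in> omega \<and> u e \<^bold>\<in> omega \<and> v e = nat_rec (t e) H (u e))"
proof (rule definable_subst3[where R = "\<lambda>x y z. x \<^bold>\<in> omega \<and> y \<^bold>\<in> omega \<and> z = nat_rec x H y",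
      OF _ assms])
  \<comment> \<open>Existence and uniqueness of the sequence replace the \<open>THE\<close> in
    \<open>nat_rec\<close> by an existential quantifier over \<open>g\<close>.\<close>
  have "x \<^bold>\<in> omega \<and> y \<^bold>\<in> omega \<and> z = nat_rec x H y \<longleftrightarrow>
    x \<^bold>\<in> omega \<and> (\<exists>g. (y \<^bold>\<in> omega \<and> rec_seq x H y g) \<and> opair y z \<^bold>\<in> g)" for x y z
    using rec_seq_ex[of y x] nat_rec_eq[of y x] app_eq_iff[of _ "succ y" omega y z]
    unfolding rec_seq_def[of x H y] by (metis mem_succ)
  then show "definable (\<lambda>e. e 0 \<^bold>\<in> omega \<and> e 1 \<^bold>\<in> omega \<and> e 2 = nat_rec (e 0) H (e 1))"
    by (simp only:) (intro definable_rec_seq definable_set_intros)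
qed

end

section \<open>Addition and multiplication as instances of recursion\<close>

lemma plus_nat_eq: "plus_nat m n = nat_rec m succ n"
  unfolding plus_nat_def nat_rec_def rec_seq_def by (simp add: conj_assoc)

lemma times_nat_eq: "times_nat m n = nat_rec zero (\<lambda>x. plus_nat x n) m"
  unfolding times_nat_def nat_rec_def rec_seq_def by (simp add: conj_assoc)

lemma succ_definable: "definable (\<lambda>e. e 0 \<^bold>\<in> omega \<and> e 1 = succ (e 0))"
  by (intro definable_set_intros)

lemma plus_nat_in: "m \<^bold>\<in> omega \<Longrightarrow> n \<^bold>\<in> omega \<Longrightarrow> plus_nat m n \<^bold>\<in> omega"
  and plus_nat_zero: "m \<^bold>\<in> omega \<Longrightarrow> plus_nat m zero = m"
  and plus_nat_succ: "m \<^bold>\<in> omega \<Longrightarrow> n \<^bold>\<in> omega \<Longrightarrow> plus_nat m (succ n) = succ (plus_nat m n)"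
  unfolding plus_nat_eq
  using nat_rec_in[OF succ_definable succ_in_omega] nat_rec_zero[OF succ_definable succ_in_omega]
    nat_rec_succ[OF succ_definable succ_in_omega] by blast+

lemma definable_plus_nat:
  assumes "definable_term t" "definable_term u" "definable_term v"
  shows "definable (\<lambda>e. t e \<^bold>\<in> omega \<and> u e \<^bold>\<in> omega \<and> v e = plus_nat (t e) (u e))"
  unfolding plus_nat_eq by (rule definable_nat_rec[OF succ_definable succ_in_omega assms])

text \<open>The form in which the recursion theorems expect the step function of multiplication,
  with \<open>n\<close> as a parameter.\<close>

lemma plus_nat_definable:
  assumes "n \<^bold>\<in> omega"
  shows "definable (\<lambda>e. e 0 \<^bold>\<in> omega \<and> e 1 = plus_nat (e 0) n)"
  using definable_plus_nat[of "\<lambda>e. e 0" "\<lambda>e. n" "\<lambda>e. e 1"] assms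
  by (simp add: definable_intros)

lemma
  assumes n: "n \<^bold>\<in> omega"
  shows times_nat_in: "m \<^bold>\<in> omega \<Longrightarrow> times_nat m n \<^bold>\<in> omega"
  and times_nat_zero: "times_nat zero n = zero"
  and times_nat_succ: "m \<^bold>\<in> omega \<Longrightarrow> times_nat (succ m) n = plus_nat (times_nat m n) n"
  unfolding times_nat_eq
  using nat_rec_in[OF plus_nat_definable[OF n] plus_nat_in[OF _ n]]
    nat_rec_zero[OF plus_nat_definable[OF n] plus_nat_in[OF _ n]]
    nat_rec_succ[OF plus_nat_definable[OF n] plus_nat_in[OF _ n]] zero_in_omega by blast+

lemma definable_times_nat:
  assumes n: "n \<^bold>\<in> omega" and "definable_term t" "definable_term u"
  shows "definable (\<lambda>e. t e \<^bold>\<in> omega \<and> u e = times_nat (t e) n)"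
proof -
  have "definable (\<lambda>e. zero \<^bold>\<in> omega \<and> t e \<^bold>\<in> omega \<and> u e = nat_rec zero (\<lambda>x. plus_nat x n) (t e))"
    by (rule definable_nat_rec[OF plus_nat_definable[OF n] plus_nat_in[OF _ n]
          definable_term_param assms(2,3)])
  then show ?thesis by (simp add: times_nat_eq)
qed

text \<open>Recursion runs on the second summand, whereas the induction on \<open>k\<close> must
  move a successor out of the first: \<open>(k n + 1) + n\<close> is
  \<open>(k n + n) + 1\<close>.\<close>

lemma plus_succ_nat:
  assumes m: "m \<^bold>\<in> omega" and "n \<^bold>\<in> omega"
  shows "plus_nat (succ m) n = succ (plus_nat m n)"
proof -
  \<comment> \<open>The sum is named by \<open>p\<close> and guarded by membership in
    \<open>omega\<close>, the form covered by \<open>definable_plus_nat\<close>.\<close>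
  have "\<exists>p. (m \<^bold>\<in> omega \<and> n \<^bold>\<in> omega \<and> p = plus_nat m n) \<and>
      (succ m \<^bold>\<in> omega \<and> n \<^bold>\<in> omega \<and> succ p = plus_nat (succ m) n)"
    using assms(2)
  proof (induction rule: omega_induct)
    case definable
    show ?case by (intro definable_plus_nat definable_set_intros)
  qed (use m in \<open>auto simp: plus_nat_zero plus_nat_succ\<close>)
  then show ?thesis by auto
qed

text \<open>With \<open>m\<close> equal to \<open>k n\<close>, this says that a set with
  \<open>(k + 1) n + 1\<close> elements has more than \<open>n\<close>, so the given choice of
  \<open>n\<close>-element subsets applies to it.\<close>

lemma in_succ_plus_nat:
  assumes m: "m \<^bold>\<in> omega" and "n \<^bold>\<in> omega"
  shows "n \<^bold>\<in> succ (plus_nat m n)"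
proof -
  have "\<exists>p. (m \<^bold>\<in> omega \<and> n \<^bold>\<in> omega \<and> p = plus_nat m n) \<and> n \<^bold>\<in> succ p"
    using assms(2)
  proof (induction rule: omega_induct)
    case definable
    show ?case by (intro definable_plus_nat definable_set_intros)
  next
    case zero
    show ?case using m zero_in_succ[OF m] by (simp add: plus_nat_zero)
  next
    case (succ n)
    then show ?case
      using m plus_nat_in[OF m] by (simp add: plus_nat_succ succ_in_succ_iff del: mem_succ)
  qed
  then show ?thesis by auto
qed

subsection \<open>Equinumerosity\<close>

text \<open>Bijections without \<open>app\<close>, so that equinumerosity becomes visibly
  first-order.\<close>

lemma equinumerous_iff:
  "equinumerous a b \<longleftrightarrow> (\<exists>f. is_fun f a b \<and> (\<forall>v. v \<^bold>\<in> b \<longrightarrow> (\<exists>!u. opair u v \<^bold>\<in> f)))"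
proof -
  have "u \<^bold>\<in> a \<and> app f u = v \<longleftrightarrow> opair u v \<^bold>\<in> f" if "is_fun f a b" for f u v
    using app_eq_iff[OF that] opair_in_fun[OF that] by blast
  then show ?thesis
    unfolding equinumerous_def is_bij_def by (simp cong: conj_cong)
qed

lemma definable_equinumerous:
  assumes "definable_term t" "definable_term u"
  shows "definable (\<lambda>e. equinumerous (t e) (u e))"
proof (rule definable_subst2[OF _ assms])
  show "definable (\<lambda>e. equinumerous (e 0) (e 1))"
    unfolding equinumerous_iff Ex1_def by (intro definable_is_fun definable_set_intros)
qed

lemma equinumerousE:
  assumes "equinumerous a b"
  obtains f where "\<And>u v. opair u v \<^bold>\<in> f \<Longrightarrow> u \<^bold>\<in> a \<and> v \<^bold>\<in> b"
    and "\<And>u. u \<^bold>\<in> a \<Longrightarrow> \<exists>v. opair u v \<^bold>\<in> f"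
    and "\<And>v. v \<^bold>\<in> b \<Longrightarrow> \<exists>u. opair u v \<^bold>\<in> f"
    and "\<And>u v w. opair u v \<^bold>\<in> f \<Longrightarrow> opair u w \<^bold>\<in> f \<Longrightarrow> v = w"
    and "\<And>u v w. opair u w \<^bold>\<in> f \<Longrightarrow> opair v w \<^bold>\<in> f \<Longrightarrow> u = v"
proof -
  obtain f where f: "is_fun f a b" "\<And>v. v \<^bold>\<in> b \<Longrightarrow> \<exists>!u. opair u v \<^bold>\<in> f"
    using assms unfolding equinumerous_iff by blast
  note in_f = opair_in_fun[OF f(1)]
  have f': "\<exists>!v. opair u v \<^bold>\<in> f" if "u \<^bold>\<in> a" for u
    using f(1) that unfolding is_fun_def by blast
  show thesis
  proof (rule that[of f])
    show "v = w" if "opair u v \<^bold>\<in> f" "opair u w \<^bold>\<in> f" for u v w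
      using f'[OF in_f(1)[OF that(1)]] that by blast
    show "u = v" if "opair u w \<^bold>\<in> f" "opair v w \<^bold>\<in> f" for u v w
      using f(2)[OF in_f(2)[OF that(1)]] that by blast
  qed (use in_f in blast, use f' in blast, use f(2) in blast)
qed

lemma equinumerousI:
  assumes "definable (\<lambda>e. R (e 0) (e 1))"
    and "\<And>u. u \<^bold>\<in> a \<Longrightarrow> \<exists>v. v \<^bold>\<in> b \<and> R u v"
    and "\<And>v. v \<^bold>\<in> b \<Longrightarrow> \<exists>u. u \<^bold>\<in> a \<and> R u v"
    and "\<And>u v w. R u v \<Longrightarrow> R u w \<Longrightarrow> v = w"
    and "\<And>u v w. R u w \<Longrightarrow> R v w \<Longrightarrow> u = v"
  shows "equinumerous a b"
proof -
  have "\<exists>f. is_fun f a b \<and> (\<forall>u v. opair u v \<^bold>\<in> f \<longleftrightarrow> u \<^bold>\<in> a \<and> v \<^bold>\<in> b \<and> R u v)"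
    using assms(1,2,4) by (rule fun_ex)
  then show ?thesis
    unfolding equinumerous_iff using assms(3,5) by metis
qed

section \<open>Removing elements from finite sets\<close>

lemma equinumerous_zero:
  assumes "equinumerous z zero"
  shows "\<not> u \<^bold>\<in> z"
  using equinumerousE[OF assms] by (metis not_mem_zero)

lemma equinumerous_succ_nonempty:
  assumes "equinumerous z (succ n)"
  shows "\<exists>u. u \<^bold>\<in> z"
  using equinumerousE[OF assms] by (metis mem_succ)

lemma equinumerous_remove:
  assumes "equinumerous z (succ n)" "x \<^bold>\<in> z"
    and d: "\<And>u. u \<^bold>\<in> d \<longleftrightarrow> u \<^bold>\<in> z \<and> u \<noteq> x"
  shows "equinumerous d n"
proof -
  obtain f where f: "\<And>u v. opair u v \<^bold>\<in> f \<Longrightarrow> u \<^bold>\<in> z \<and> v \<^bold>\<in> succ n"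
    "\<And>u. u \<^bold>\<in> z \<Longrightarrow> \<exists>v. opair u v \<^bold>\<in> f"
    "\<And>v. v \<^bold>\<in> succ n \<Longrightarrow> \<exists>u. opair u v \<^bold>\<in> f"
    "\<And>u v w. opair u v \<^bold>\<in> f \<Longrightarrow> opair u w \<^bold>\<in> f \<Longrightarrow> v = w"
    "\<And>u v w. opair u w \<^bold>\<in> f \<Longrightarrow> opair v w \<^bold>\<in> f \<Longrightarrow> u = v"
    using equinumerousE[OF assms(1)] by blast
  obtain i where i: "opair x i \<^bold>\<in> f"
    using f(2) assms(2) by blast
  obtain l where l: "opair l n \<^bold>\<in> f"
    using f(3)[of n] by auto
  \<comment> \<open>The preimage \<open>l\<close> of \<open>n\<close> takes over the value \<open>i\<close> of the removed element.\<close>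
  define R where "R u v \<longleftrightarrow> u \<noteq> x \<and> (opair u v \<^bold>\<in> f \<and> v \<noteq> n \<or> u = l \<and> v = i)" for u v
  show ?thesis
  proof (rule equinumerousI[of R])
    show "definable (\<lambda>e. R (e 0) (e 1))"
      unfolding R_def by (intro definable_set_intros)
    show "\<exists>v. v \<^bold>\<in> n \<and> R u v" if u: "u \<^bold>\<in> d" for u
    proof (cases "u = l")
      case True
      \<comment> \<open>If \<open>i = n\<close>, then \<open>x\<close> and \<open>l\<close> have the
        same value and injectivity gives \<open>l = x\<close>, but \<open>u = l\<close> lies in
        \<open>d\<close>.\<close>
      then have "i \<noteq> n" using u d f(5)[OF l] i by blast
      then show ?thesis using True u d f(1)[OF i] by (auto simp: R_def)
    next
      case False
      obtain v where v: "opair u v \<^bold>\<in> f" using u d f(2) by blast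
      then have "v \<noteq> n" using False f(5) l by blast
      then show ?thesis using v u d f(1)[OF v] by (auto simp: R_def)
    qed
    show "\<exists>u. u \<^bold>\<in> d \<and> R u v" if v: "v \<^bold>\<in> n" for v
    proof (cases "v = i")
      case True
      \<comment> \<open>If \<open>l = x\<close>, then \<open>i = n\<close>, and \<open>v = i\<close>
        would make \<open>n\<close> a member of itself.\<close>
      then have "l \<noteq> x" using f(4)[OF i] l v mem_irrefl by blast
      then show ?thesis using True d f(1)[OF l] by (auto simp: R_def)
    next
      case False
      obtain u where u: "opair u v \<^bold>\<in> f" using v f(3)[of v] by auto
      then have "u \<noteq> x" "v \<noteq> n" using False f(4) i v by auto
      then show ?thesis using u d f(1)[OF u] by (auto simp: R_def)
    qed
    show "v = w" if "R u v" "R u w" for u v w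
      using that f(4) l unfolding R_def by blast
    show "u = v" if "R u w" "R v w" for u v w
      using that f(5) i unfolding R_def by blast
  qed
qed

lemma remove_ex: "\<exists>d. \<forall>u. u \<^bold>\<in> d \<longleftrightarrow> u \<^bold>\<in> z \<and> u \<noteq> x"
proof -
  have "definable (\<lambda>e. e 0 \<noteq> x)"
    by (intro definable_set_intros)
  then show ?thesis by (rule separation_definable)
qed

lemma diff_ex: "\<exists>d. \<forall>u. u \<^bold>\<in> d \<longleftrightarrow> u \<^bold>\<in> z \<and> \<not> u \<^bold>\<in> w"
proof -
  have "definable (\<lambda>e. \<not> e 0 \<^bold>\<in> w)"
    by (intro definable_set_intros)
  then show ?thesis by (rule separation_definable)
qed

lemma equinumerous_one:
  assumes "equinumerous z (succ zero)"
  shows "\<exists>x. \<forall>u. u \<^bold>\<in> z \<longleftrightarrow> u = x"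
proof -
  obtain x where x: "x \<^bold>\<in> z"
    using equinumerous_succ_nonempty[OF assms] by blast
  obtain d where d: "\<And>u. u \<^bold>\<in> d \<longleftrightarrow> u \<^bold>\<in> z \<and> u \<noteq> x"
    using remove_ex by blast
  have "\<not> u \<^bold>\<in> d" for u
    using equinumerous_zero[OF equinumerous_remove[OF assms x d]] .
  then show ?thesis using x d by blast
qed

text \<open>Induction on \<open>n\<close>: one element of \<open>w\<close> is taken out of both
  \<open>w\<close> and \<open>z\<close>, and \<open>equinumerous_remove\<close> handles each of
  them.\<close>

lemma equinumerous_diff:
  assumes m: "m \<^bold>\<in> omega" and n: "n \<^bold>\<in> omega"
    and w: "w \<^bold>\<subseteq> z" "equinumerous w n" and z: "equinumerous z (plus_nat m n)"
    and d: "\<And>u. u \<^bold>\<in> d \<longleftrightarrow> u \<^bold>\<in> z \<and> \<not> u \<^bold>\<in> w"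
  shows "equinumerous d m"
proof -
  \<comment> \<open>The sets are quantified inside the statement because the induction hypothesis is
    applied to smaller ones. The variable \<open>p\<close> names the guarded sum.\<close>
  have "\<forall>z w d p. w \<^bold>\<subseteq> z \<longrightarrow> equinumerous w n \<longrightarrow>
      (m \<^bold>\<in> omega \<and> n \<^bold>\<in> omega \<and> p = plus_nat m n) \<longrightarrow> equinumerous z p \<longrightarrow>
      (\<forall>u. u \<^bold>\<in> d \<longleftrightarrow> u \<^bold>\<in> z \<and> \<not> u \<^bold>\<in> w) \<longrightarrow> equinumerous d m"
    using n
  proof (induction rule: omega_induct)
    case definable
    show ?case
      by (intro definable_plus_nat definable_equinumerous definable_set_intros)
  next
    case zero
    show ?case
    proof (intro allI impI)
      fix z w d p
      assume "equinumerous w zero" and p: "m \<^bold>\<in> omega \<and> zero \<^bold>\<in> omega \<and> p = plus_nat m zero"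
        and z: "equinumerous z p" and d: "\<forall>u. u \<^bold>\<in> d \<longleftrightarrow> u \<^bold>\<in> z \<and> \<not> u \<^bold>\<in> w"
      then have "d = z"
        using equinumerous_zero by (intro extensionality) blast
      then show "equinumerous d m"
        using z p by (simp add: plus_nat_zero)
    qed
  next
    case (succ n)
    show ?case
    proof (intro allI impI)
      fix z w d p
      assume wz: "w \<^bold>\<subseteq> z" and w: "equinumerous w (succ n)"
        and p: "m \<^bold>\<in> omega \<and> succ n \<^bold>\<in> omega \<and> p = plus_nat m (succ n)"
        and z: "equinumerous z p" and d: "\<forall>u. u \<^bold>\<in> d \<longleftrightarrow> u \<^bold>\<in> z \<and> \<not> u \<^bold>\<in> w"
      obtain x where x: "x \<^bold>\<in> w"
        using equinumerous_succ_nonempty[OF w] by blast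
      obtain w' where w': "\<And>u. u \<^bold>\<in> w' \<longleftrightarrow> u \<^bold>\<in> w \<and> u \<noteq> x"
        using remove_ex by blast
      obtain z' where z': "\<And>u. u \<^bold>\<in> z' \<longleftrightarrow> u \<^bold>\<in> z \<and> u \<noteq> x"
        using remove_ex by blast
      have "equinumerous z (succ (plus_nat m n))"
        using z p m \<open>n \<^bold>\<in> omega\<close> by (simp add: plus_nat_succ)
      then have "equinumerous z' (plus_nat m n)"
        by (rule equinumerous_remove[OF _ _ z']) (use x wz in \<open>simp add: subset_def\<close>)
      moreover have "equinumerous w' n"
        by (rule equinumerous_remove[OF w x w'])
      \<comment> \<open>Since \<open>x\<close> leaves both sets, their difference is still
        \<open>d\<close>.\<close>
      moreover have "w' \<^bold>\<subseteq> z'" "\<forall>u. u \<^bold>\<in> d \<longleftrightarrow> u \<^bold>\<in> z' \<and> \<not> u \<^bold>\<in> w'"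
        using wz d x unfolding subset_def w' z' by blast+
      ultimately show "equinumerous d m"
        using succ.IH m \<open>n \<^bold>\<in> omega\<close> by blast
    qed
  qed
  then show ?thesis using assms by blast
qed

lemma mem_subsets_eq: "z \<^bold>\<in> subsets_eq x n \<longleftrightarrow> z \<^bold>\<subseteq> x \<and> equinumerous z n"
proof -
  obtain p where "\<And>z. z \<^bold>\<in> p \<longleftrightarrow> z \<^bold>\<subseteq> x"
    using power_set by blast
  then show ?thesis
    unfolding subsets_eq_def
    by (intro mem_coll_bounded[where x = p] definable_equinumerous definable_set_intros) simp
qed

lemma mem_subsets_gt: "z \<^bold>\<in> subsets_gt x n \<longleftrightarrow>
  z \<^bold>\<subseteq> x \<and> (\<exists>m. m \<^bold>\<in> omega \<and> n \<^bold>\<in> m \<and> equinumerous z m)"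
proof -
  obtain p where "\<And>z. z \<^bold>\<in> p \<longleftrightarrow> z \<^bold>\<subseteq> x"
    using power_set by blast
  then show ?thesis
    unfolding subsets_gt_def
    by (intro mem_coll_bounded[where x = p] definable_equinumerous definable_set_intros) simp
qed

subsection \<open>Choice functions\<close>

text \<open>The witness demanded by \<open>RC m\<close>, on a prescribed \<open>y\<close>. The same
  \<open>y\<close> is kept throughout the induction on \<open>k\<close>.\<close>

definition chooser :: "'a \<Rightarrow> 'a \<Rightarrow> 'a \<Rightarrow> bool" where
  "chooser y m g \<longleftrightarrow> is_fun g (subsets_eq y m) y \<and> (\<forall>z. z \<^bold>\<in> subsets_eq y m \<longrightarrow> app g z \<^bold>\<in> z)"

lemma chooser_iff:
  "chooser y m g \<longleftrightarrow> is_fun g (subsets_eq y m) y \<and> (\<forall>z v. opair z v \<^bold>\<in> g \<longrightarrow> v \<^bold>\<in> z)"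
  using app_eq_iff[of g "subsets_eq y m" y] opair_in_fun(1)[of g "subsets_eq y m" y]
  unfolding chooser_def by metis

lemma definable_chooser:
  assumes "definable_term t" "definable_term u"
  shows "definable (\<lambda>e. chooser y (t e) (u e))"
proof (rule definable_subst2[OF _ assms])
  \<comment> \<open>The \<open>coll\<close> term \<open>subsets_eq y m\<close> depends on the
    environment, so a variable \<open>x\<close> with the same members takes its place.\<close>
  have "chooser y m g \<longleftrightarrow> (\<exists>x. (\<forall>z. z \<^bold>\<in> x \<longleftrightarrow> z \<^bold>\<subseteq> y \<and> equinumerous z m) \<and>
      is_fun g x y \<and> (\<forall>z v. opair z v \<^bold>\<in> g \<longrightarrow> v \<^bold>\<in> z))" for m g
    unfolding chooser_iff mem_subsets_eq[symmetric] eq_iff[symmetric] by blast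
  then show "definable (\<lambda>e. chooser y (e 0) (e 1))"
    by (simp only:) (intro definable_equinumerous definable_is_fun definable_set_intros)
qed

text \<open>As \<open>R\<close> is single-valued, the function is obtained by Separation and nothing
  is chosen. Membership of \<open>v\<close> in \<open>z\<close> is added to \<open>R\<close> in the
  proof.\<close>

lemma chooser_ex:
  assumes "definable (\<lambda>e. R (e 0) (e 1))"
    and "\<And>z. z \<^bold>\<subseteq> y \<Longrightarrow> equinumerous z m \<Longrightarrow> \<exists>v. v \<^bold>\<in> z \<and> R z v"
    and "\<And>z v w. R z v \<Longrightarrow> R z w \<Longrightarrow> v = w"
  shows "\<exists>g. chooser y m g"
proof -
  have "definable (\<lambda>e. e 1 \<^bold>\<in> e 0 \<and> R (e 0) (e 1))"
    by (intro definable_conj assms(1)) (intro definable_set_intros)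
  then have "\<exists>g. is_fun g (subsets_eq y m) y \<and> (\<forall>z v. opair z v \<^bold>\<in> g \<longleftrightarrow>
      z \<^bold>\<in> subsets_eq y m \<and> v \<^bold>\<in> y \<and> v \<^bold>\<in> z \<and> R z v)"
    by (rule fun_ex[where R = "\<lambda>z v. v \<^bold>\<in> z \<and> R z v"])
      (use assms(2,3) in \<open>unfold mem_subsets_eq subset_def, blast+\<close>)
  then show ?thesis
    unfolding chooser_iff by blast
qed

text \<open>The case \<open>k = 0\<close>: a one-element set leaves only one candidate.\<close>

lemma chooser_one: "\<exists>g. chooser y (succ zero) g"
proof (rule chooser_ex)
  show "definable (\<lambda>e. \<forall>u. u \<^bold>\<in> e 0 \<longleftrightarrow> u = e 1)"
    by (intro definable_set_intros)
qed (use equinumerous_one in blast)+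

text \<open>The hypothesis \<open>nm\<close> makes \<open>f\<close> applicable to sets with
  \<open>m + n\<close> elements; removing \<open>f z\<close> leaves \<open>m\<close> elements, as
  \<open>g\<close> requires.\<close>

lemma chooser_plus_nat:
  assumes m: "m \<^bold>\<in> omega" and n: "n \<^bold>\<in> omega" and nm: "n \<^bold>\<in> plus_nat m n"
    and f: "is_fun f (subsets_gt y n) (subsets_eq y n)"
    and fz: "\<And>z. z \<^bold>\<in> subsets_gt y n \<Longrightarrow> app f z \<^bold>\<subseteq> z"
    and g: "chooser y m g"
  shows "\<exists>h. chooser y (plus_nat m n) h"
proof (rule chooser_ex)
  \<comment> \<open>Here \<open>w\<close> is \<open>f z\<close> and \<open>d\<close> is the rest of
    \<open>z\<close>; both are named through graphs and members to keep the relation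
    definable.\<close>
  let ?R = "\<lambda>z v. \<exists>w d. opair z w \<^bold>\<in> f \<and> (\<forall>u. u \<^bold>\<in> d \<longleftrightarrow> u \<^bold>\<in> z \<and> \<not> u \<^bold>\<in> w) \<and> opair d v \<^bold>\<in> g"
  show "definable (\<lambda>e. ?R (e 0) (e 1))"
    by (intro definable_set_intros)
  have g': "is_fun g (subsets_eq y m) y" "\<And>z v. opair z v \<^bold>\<in> g \<Longrightarrow> v \<^bold>\<in> z"
    using g unfolding chooser_iff by blast+
  show "\<exists>v. v \<^bold>\<in> z \<and> ?R z v" if z: "z \<^bold>\<subseteq> y" "equinumerous z (plus_nat m n)" for z
  proof -
    have z_gt: "z \<^bold>\<in> subsets_gt y n"
      using z nm plus_nat_in[OF m n] unfolding mem_subsets_gt by blast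
    let ?w = "app f z"
    have w: "opair z ?w \<^bold>\<in> f" "equinumerous ?w n"
      using app_eq_iff[OF f z_gt] app_in[OF f z_gt] unfolding mem_subsets_eq by blast+
    obtain d where d: "\<And>u. u \<^bold>\<in> d \<longleftrightarrow> u \<^bold>\<in> z \<and> \<not> u \<^bold>\<in> ?w"
      using diff_ex by blast
    have "equinumerous d m"
      by (rule equinumerous_diff[OF m n fz[OF z_gt] w(2) z(2) d])
    then have "d \<^bold>\<in> subsets_eq y m"
      using z(1) d unfolding mem_subsets_eq subset_def by blast
    then have "opair d (app g d) \<^bold>\<in> g"
      using app_eq_iff[OF g'(1)] by blast
    then show ?thesis
      using d w(1) g'(2) by blast
  qed
  show "v = v'" if R: "?R z v" "?R z v'" for z v v'
  proof -
    obtain w d where 1: "opair z w \<^bold>\<in> f" "\<And>u. u \<^bold>\<in> d \<longleftrightarrow> u \<^bold>\<in> z \<and> \<not> u \<^bold>\<in> w" "opair d v \<^bold>\<in> g"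
      using R(1) by blast
    obtain w' d' where 2: "opair z w' \<^bold>\<in> f" "\<And>u. u \<^bold>\<in> d' \<longleftrightarrow> u \<^bold>\<in> z \<and> \<not> u \<^bold>\<in> w'"
      "opair d' v' \<^bold>\<in> g"
      using R(2) by blast
    have "w = w'"
      using app_eq_iff[OF f opair_in_fun(1)[OF f 1(1)]] 1(1) 2(1) by metis
    then have "d = d'"
      using 1(2) 2(2) by (simp add: eq_iff)
    then show ?thesis
      using app_eq_iff[OF g'(1) opair_in_fun(1)[OF g'(1) 1(3)]] 1(3) 2(3) by metis
  qed
qed

lemma chooser_times_nat:
  assumes "k \<^bold>\<in> omega" and n: "n \<^bold>\<in> omega"
    and f: "is_fun f (subsets_gt y n) (subsets_eq y n)"
    and fz: "\<And>z. z \<^bold>\<in> subsets_gt y n \<Longrightarrow> app f z \<^bold>\<subseteq> z"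
  shows "\<exists>g. chooser y (succ (times_nat k n)) g"
proof -
  \<comment> \<open>The variable \<open>t\<close> names the product, since
    \<open>definable_times_nat\<close> gives its graph only together with the guard on
    \<open>k\<close>.\<close>
  have "\<exists>t g. (k \<^bold>\<in> omega \<and> t = times_nat k n) \<and> chooser y (succ t) g"
    using assms(1)
  proof (induction rule: omega_induct)
    case definable
    show ?case
      by (intro definable_times_nat[OF n] definable_chooser definable_set_intros)
  next
    case zero
    show ?case using chooser_one by (simp add: times_nat_zero[OF n])
  next
    case (succ k)
    let ?t = "times_nat k n"
    have t: "?t \<^bold>\<in> omega"
      using times_nat_in[OF n] \<open>k \<^bold>\<in> omega\<close> .
    obtain g where "chooser y (succ ?t) g"
      using succ.IH by blast
    \<comment> \<open>Moving the successor outwards, the new size \<open>succ ?t + n\<close> is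
      \<open>succ (?t + n)\<close>, one more than the next multiple of \<open>n\<close>.\<close>
    then have "\<exists>h. chooser y (plus_nat (succ ?t) n) h"
      using t n f fz in_succ_plus_nat[OF t n]
      by (intro chooser_plus_nat) (simp_all add: plus_succ_nat)
    then show ?case
      using t n \<open>k \<^bold>\<in> omega\<close> by (simp add: times_nat_succ plus_succ_nat)
  qed
  then show ?thesis by blast
qed

end

theorem lemma9p1:
  fixes E :: "'a \<Rightarrow> 'a \<Rightarrow> bool"
  assumes "ZF_model E"
  shows "\<forall>k n. E k (membership.omega E) \<longrightarrow> E n (membership.omega E) \<longrightarrow>
    membership.nRC_fin E n \<longrightarrow>
    membership.RC E (membership.succ E (membership.times_nat E k n))"
proof -
  interpret ZF_model E by fact
  show ?thesis
  proof (intro allI impI)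
    fix k n assume "E k omega" "E n omega" and n: "nRC_fin n"
    show "RC (succ (times_nat k n))"
      unfolding RC_def
    proof (intro allI impI)
      fix x assume "\<not> is_finite x"
      \<comment> \<open>The infinite subset supplied by \<open>nRC_fin\<close> serves for
        \<open>RC\<close> as well; only the choice function changes.\<close>
      then obtain y f where "subset y x" "\<not> is_finite y"
        "is_fun f (subsets_gt y n) (subsets_eq y n)"
        "\<And>z. E z (subsets_gt y n) \<Longrightarrow> subset (app f z) z"
        using n unfolding nRC_fin_def by blast
      then show "\<exists>y f. subset y x \<and> \<not> is_finite y \<and>
          is_fun f (subsets_eq y (succ (times_nat k n))) y \<and>
          (\<forall>z. E z (subsets_eq y (succ (times_nat k n))) \<longrightarrow> E (app f z) z)"
        using chooser_times_nat[OF \<open>E k omega\<close> \<open>E n omega\<close>] unfolding chooser_def by blast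
    qed
  qed
qed

end
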